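(* Let $G$ be a finite simple graph with no isolated vertices. Assume that $G$ is bull-free, where the bull is the graph on vertices $a,b,c,d,e$ with edges $ab,bc,ca,ad,be$. Assume further that $G$ is not isomorphic to any of the following six graphs: (1) $K_{1,3}$; (2) $K_{2,3}$; (3) $K_{3,3}$; (4) the graph obtained from $K_{1,3}$ with center $b$ and leaves $c_1,c_2,c_3$ by adding one vertex adjacent exactly to $c_2$ and $c_3$; (5) the graph obtained from $K_{1,3}$ with center $b$ and leaves $c_1,c_2,c_3$ by adding a vertex $d_1$ adjacent exactly to $c_2,c_3$ and a vertex $d_2$ adjacent exactly to $c_1,c_2$ ($d_1,d_2$ nonadjacent); (6) the graph obtained from $K_{2,3}$ with parts $\{b_1,b_2\}$ and $\{c_1,c_2,c_3\}$ by adding one vertex adjacent exactly to $c_2$ and $c_3$. Then $G$ is claw-free if and only if $G/e$ is claw-free for every edge $e\in E(G)$.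
   Context: All graphs are finite and simple. The claw is $K_{1,3}$. A graph is $H$-free if it has no induced subgraph isomorphic to $H$. For an edge $e=uv$ of $G$, the contraction $G/e$ is obtained from $G$ by deleting $u$ and $v$ and adding a new vertex adjacent to every vertex of $(N(u)\cup N(v))\setminus\{u,v\}$. *)

theory Defs
  imports "Graph_Theory.Graph_Theory"
begin

text \<open>Finite simple graphs are rendered as \<open>pair_graph\<close>: finite, symmetric, loop-free digraphs
  whose arcs are pairs of vertices, so that the edge \<open>uv\<close> is present as both \<open>(u,v)\<close> and \<open>(v,u)\<close>.\<close>

definition nbrs :: "'a pair_pre_digraph \<Rightarrow> 'a \<Rightarrow> 'a set" where
  "nbrs G u = {v. (u, v) \<in> parcs G}"

definition no_isolated_verts :: "'a pair_pre_digraph \<Rightarrow> bool" where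
  "no_isolated_verts G \<longleftrightarrow> (\<forall>v\<in>pverts G. nbrs G v \<noteq> {})"

definition graph_isomorphic :: "'a pair_pre_digraph \<Rightarrow> 'b pair_pre_digraph \<Rightarrow> bool" where
  "graph_isomorphic G H \<longleftrightarrow> digraph_iso (with_proj G) (with_proj H)"

lemma graph_isomorphic_iff:
  assumes "pair_graph G" "pair_graph H"
  shows "graph_isomorphic G H \<longleftrightarrow>
    (\<exists>f. bij_betw f (pverts G) (pverts H) \<and>
      (\<forall>u\<in>pverts G. \<forall>v\<in>pverts G. (u, v) \<in> parcs G \<longleftrightarrow> (f u, f v) \<in> parcs H))"
    (is "?L \<longleftrightarrow> ?R")
proof -
  interpret G: pair_graph G by fact
  interpret H: pair_graph H by fact
  show ?thesis
  proof
    assume ?L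
    then obtain h where iso: "pre_digraph.digraph_isomorphism (with_proj G) h"
      and app: "with_proj H = app_iso h (with_proj G)"
      by (auto simp: graph_isomorphic_def digraph_iso_def)
    have verts: "pverts H = iso_verts h ` pverts G" and arcs: "parcs H = iso_arcs h ` parcs G"
      and ends: "iso_tail h = fst" "iso_head h = snd"
      using app by (auto simp: with_proj_def app_iso_def)
    have inj: "inj_on (iso_verts h) (pverts G)"
      using iso by (simp add: G.digraph_isomorphism_def)
    have arc: "iso_arcs h e = (iso_verts h (fst e), iso_verts h (snd e))" if "e \<in> parcs G" for e
      using iso that ends by (auto simp: G.digraph_isomorphism_def prod_eq_iff)
    have "(u, v) \<in> parcs G \<longleftrightarrow> (iso_verts h u, iso_verts h v) \<in> parcs H"
      if "u \<in> pverts G" "v \<in> pverts G" for u v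
    proof
      assume "(u, v) \<in> parcs G"
      then show "(iso_verts h u, iso_verts h v) \<in> parcs H"
        using arc unfolding arcs by force
    next
      assume "(iso_verts h u, iso_verts h v) \<in> parcs H"
      then obtain e where e: "e \<in> parcs G" "iso_arcs h e = (iso_verts h u, iso_verts h v)"
        unfolding arcs by auto
      then have "fst e = u" "snd e = v"
        using arc that inj G.arc_fst_in_verts G.arc_snd_in_verts by (auto dest: inj_onD)
      then show "(u, v) \<in> parcs G"
        using e(1) by auto
    qed
    then show ?R
      using inj verts by (auto simp: bij_betw_def)
  next
    assume ?R
    then obtain f where f: "bij_betw f (pverts G) (pverts H)"
      and arc: "\<And>u v. u \<in> pverts G \<Longrightarrow> v \<in> pverts G \<Longrightarrow>
        (u, v) \<in> parcs G \<longleftrightarrow> (f u, f v) \<in> parcs H"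
      by blast
    define h where "h = \<lparr> iso_verts = f, iso_arcs = map_prod f f, iso_head = snd, iso_tail = fst \<rparr>"
    have inj: "inj_on f (pverts G)" and im: "f ` pverts G = pverts H"
      using f by (auto simp: bij_betw_def)
    have "inj_on (map_prod f f) (pverts G \<times> pverts G)"
      using inj by (intro map_prod_inj_on)
    moreover have "parcs G \<subseteq> pverts G \<times> pverts G"
      by (auto dest: G.in_arcsD1 G.in_arcsD2)
    ultimately have "inj_on (map_prod f f) (parcs G)"
      by (rule inj_on_subset)
    then have "G.digraph_isomorphism h"
      using inj G.wf_digraph_axioms by (auto simp: G.digraph_isomorphism_def h_def)
    moreover have "parcs H = map_prod f f ` parcs G"
    proof (intro equalityI subsetI)
      fix e assume e: "e \<in> parcs H"
      then have "fst e \<in> f ` pverts G" "snd e \<in> f ` pverts G"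
        using im H.arc_fst_in_verts H.arc_snd_in_verts by auto
      then obtain u v where "u \<in> pverts G" "v \<in> pverts G" "e = (f u, f v)"
        by (metis imageE prod.collapse)
      then show "e \<in> map_prod f f ` parcs G"
        using e arc by force
    next
      fix e assume "e \<in> map_prod f f ` parcs G"
      then obtain u v where uv: "(u, v) \<in> parcs G" "e = (f u, f v)"
        by auto
      then show "e \<in> parcs H"
        using arc[OF G.in_arcsD1[OF uv(1)] G.in_arcsD2[OF uv(1)]] by simp
    qed
    then have "with_proj H = app_iso h (with_proj G)"
      using im by (simp add: with_proj_def app_iso_def h_def)
    ultimately show ?L
      by (auto simp: graph_isomorphic_def digraph_iso_def)
  qed
qed

definition induced_free :: "'b pair_pre_digraph \<Rightarrow> 'a pair_pre_digraph \<Rightarrow> bool" where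
  "induced_free H G \<longleftrightarrow>
     \<not> (\<exists>S. induced_subgraph S (with_proj G) \<and> digraph_iso S (with_proj H))"

text \<open>The contraction \<open>G/uv\<close>: the new vertex is \<open>None\<close>, and a surviving vertex \<open>x\<close> becomes
  \<open>Some x\<close>, so the new vertex is fresh whatever the vertex type is.\<close>

definition contract_edge :: "'a pair_pre_digraph \<Rightarrow> 'a \<Rightarrow> 'a \<Rightarrow> 'a option pair_pre_digraph" where
  "contract_edge G u v =
     \<lparr> pverts = insert None (Some ` (pverts G - {u, v})),
       parcs = {(Some x, Some y) |x y. (x, y) \<in> parcs G \<and> x \<notin> {u, v} \<and> y \<notin> {u, v}}
             \<union> {None} \<times> Some ` ((nbrs G u \<union> nbrs G v) - {u, v})
             \<union> Some ` ((nbrs G u \<union> nbrs G v) - {u, v}) \<times> {None} \<rparr>"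

lemma pair_graph_contract_edge:
  assumes "pair_graph G"
  shows "pair_graph (contract_edge G u v)"
proof -
  interpret pair_graph G by fact
  let ?C = "contract_edge G u v"
  have sub: "parcs ?C \<subseteq> pverts ?C \<times> pverts ?C"
    by (auto simp: contract_edge_def nbrs_def dest: in_arcsD1 in_arcsD2)
  have fin: "finite (pverts ?C)"
    by (simp add: contract_edge_def)
  show ?thesis
  proof
    show "finite (parcs ?C)"
      using sub fin by (meson finite_SigmaI finite_subset)
    show "symmetric (with_proj ?C)"
      by (auto simp: symmetric_def contract_edge_def intro!: symI dest: arcs_symmetric)
  next
    fix e assume "e \<in> parcs ?C"
    then show "fst e \<noteq> snd e"
      by (auto simp: contract_edge_def dest: no_loops')
  qed (use sub fin in auto)
qed

text \<open>The graph without isolated vertices with edge set \<open>{uv. (u,v) \<in> E}\<close>; every edge needs to be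
  listed in only one direction.\<close>

definition graph_of_edges :: "'a rel \<Rightarrow> 'a pair_pre_digraph" where
  "graph_of_edges E = \<lparr> pverts = Field E, parcs = E \<union> E\<inverse> \<rparr>"

lemma pair_graph_graph_of_edges:
  assumes "finite E" "irrefl E"
  shows "pair_graph (graph_of_edges E)"
  using assms
  by unfold_locales
    (auto simp: graph_of_edges_def Field_def symmetric_def irrefl_def finite_Domain finite_Range
      intro!: symI)

definition complete_bipartite :: "nat \<Rightarrow> nat \<Rightarrow> nat pair_pre_digraph" where
  "complete_bipartite m n = graph_of_edges ({0..<m} \<times> {m..<m + n})"

text \<open>For \<open>m = 0\<close> or \<open>n = 0\<close> the vertices would be lost; only positive \<open>m\<close> and \<open>n\<close> are used.\<close>

lemma complete_bipartite_is_K: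
  assumes "m > 0" "n > 0"
  shows "K\<^bsub>m,n\<^esub> (with_proj (complete_bipartite m n))"
  unfolding complete_bipartite_digraph_pair_def
proof (intro conjI exI)
  have "(0, m) \<in> {0..<m} \<times> {m..<m + n}"
    using assms by simp
  then have "Field ({0..<m} \<times> {m..<m + n}) = {0..<m} \<union> {m..<m + n}"
    unfolding Field_def by blast
  then show "pverts (complete_bipartite m n) = {0..<m} \<union> {m..<m + n}"
    by (simp add: complete_bipartite_def graph_of_edges_def)
  then show "finite (pverts (complete_bipartite m n))"
    by simp
qed (auto simp: complete_bipartite_def graph_of_edges_def)

abbreviation claw :: "nat pair_pre_digraph" where
  "claw \<equiv> complete_bipartite 1 3"

text \<open>\<open>a, b, c, d, e = 0, 1, 2, 3, 4\<close>\<close>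

definition bull :: "nat pair_pre_digraph" where
  "bull = graph_of_edges {(0,1), (1,2), (2,0), (0,3), (1,4)}"

text \<open>\<open>b, c\<^sub>1, c\<^sub>2, c\<^sub>3 = 0, 1, 2, 3\<close>; the added vertices are \<open>4\<close>, respectively
  \<open>d\<^sub>1, d\<^sub>2 = 4, 5\<close>.\<close>

definition claw_plus_one :: "nat pair_pre_digraph" where
  "claw_plus_one = graph_of_edges {(0,1), (0,2), (0,3), (4,2), (4,3)}"

definition claw_plus_two :: "nat pair_pre_digraph" where
  "claw_plus_two = graph_of_edges {(0,1), (0,2), (0,3), (4,2), (4,3), (5,1), (5,2)}"

text \<open>\<open>b\<^sub>1, b\<^sub>2 = 0, 1\<close> and \<open>c\<^sub>1, c\<^sub>2, c\<^sub>3 = 2, 3, 4\<close>; the added vertex is \<open>5\<close>.\<close>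

definition K23_plus_one :: "nat pair_pre_digraph" where
  "K23_plus_one = graph_of_edges {(0,2), (0,3), (0,4), (1,2), (1,3), (1,4), (5,3), (5,4)}"

end

theory Submission
  imports Defs
begin

text \<open>If \<open>G\<close> is claw-free and \<open>G/uv\<close> has a claw, then its centre is the new vertex, two of its
  leaves are attached to one end of \<open>uv\<close> and the third only to the other; claw-freeness at the first
  end then yields a triangle, which the remaining two leaves complete to a bull.

  Conversely, suppose that \<open>G\<close> has a claw but no \<open>G/e\<close> does. Contracting edges that meet the claw
  in at most one vertex shows that its centre has degree three, that the vertices outside the claw
  are independent and that each of them is adjacent to at least two leaves. Two outside vertices with
  a common neighbour among the leaves form a second claw together with the centre, and the same
  facts about this claw rule out a third outside vertex. The few remaining graphs are the
  exceptions, apart from those with two outside vertices attached to the same two leaves, where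
  contracting the edge from the centre to one of these leaves creates a claw.\<close>

section \<open>Induced subgraphs and isomorphisms by lists of vertices\<close>

text \<open>Replaces the existential over subgraphs by an injection that preserves and reflects
  arcs, which can be given explicitly for a concrete \<open>H\<close>.\<close>

lemma induced_free_iff_embedding:
  assumes "pair_graph G" "pair_graph H"
  shows "induced_free H G \<longleftrightarrow>
    \<not> (\<exists>f. inj_on f (pverts H) \<and> f ` pverts H \<subseteq> pverts G \<and>
      (\<forall>u\<in>pverts H. \<forall>v\<in>pverts H. (f u, f v) \<in> parcs G \<longleftrightarrow> (u, v) \<in> parcs H))"
    (is "_ \<longleftrightarrow> \<not> ?R")
proof -
  interpret G: pair_graph G by fact
  interpret H: pair_graph H by fact
  have "(\<exists>S. induced_subgraph S (with_proj G) \<and> digraph_iso S (with_proj H)) \<longleftrightarrow> ?R"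
  proof
    assume "\<exists>S. induced_subgraph S (with_proj G) \<and> digraph_iso S (with_proj H)"
    then obtain S where ind: "induced_subgraph S (with_proj G)"
      and iso: "digraph_iso S (with_proj H)"
      by blast
    \<comment> \<open>An induced subgraph of \<open>with_proj G\<close> inherits \<open>fst\<close>
      and \<open>snd\<close> as its end maps, so it is \<open>with_proj P\<close> for a pair graph
      \<open>P\<close>, and \<open>graph_isomorphic_iff\<close> applies.\<close>
    define P where "P = \<lparr> pverts = verts S, parcs = arcs S \<rparr>"
    have arcs: "arcs S = {e \<in> parcs G. fst e \<in> verts S \<and> snd e \<in> verts S}"
      and verts: "verts S \<subseteq> pverts G" and ends: "tail S = fst" "head S = snd"
      using ind by (auto simp: induced_subgraph_def subgraph_def compatible_def)
    have S: "S = with_proj P"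
      using ends by (simp add: P_def with_proj_def)
    have "pair_graph P"
    proof
      show "finite (pverts P)"
        using verts G.pair_finite_verts by (auto simp: P_def intro: finite_subset)
      show "finite (parcs P)"
        using arcs G.pair_finite_arcs by (auto simp: P_def intro: finite_subset)
      show "symmetric (with_proj P)"
        by (auto simp: symmetric_def P_def arcs intro!: symI dest: G.arcs_symmetric)
    qed (auto simp: P_def arcs dest: G.no_loops')
    then obtain f where f: "bij_betw f (pverts P) (pverts H)"
      and arc: "\<forall>u\<in>pverts P. \<forall>v\<in>pverts P. (u, v) \<in> parcs P \<longleftrightarrow> (f u, f v) \<in> parcs H"
      using iso graph_isomorphic_iff[OF _ assms(2), of P]
      unfolding S graph_isomorphic_def by blast
    \<comment> \<open>The isomorphism runs from the subgraph to \<open>H\<close>; the embedding is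
      its inverse.\<close>
    define g where "g = inv_into (pverts P) f"
    have g: "bij_betw g (pverts H) (pverts P)"
      unfolding g_def using f by (rule bij_betw_inv_into)
    have fg: "f (g u) = u" "g u \<in> verts S" if "u \<in> pverts H" for u
      using that f g by (auto simp: g_def bij_betw_inv_into_right P_def dest: bij_betwE)
    have "(g u, g v) \<in> parcs G \<longleftrightarrow> (u, v) \<in> parcs H"
      if "u \<in> pverts H" "v \<in> pverts H" for u v
      using arc fg[OF that(1)] fg[OF that(2)] by (auto simp: P_def arcs)
    then show ?R
      using g verts by (intro exI[of _ g]) (auto simp: bij_betw_def P_def)
  next
    assume ?R
    then obtain f where inj: "inj_on f (pverts H)" and im: "f ` pverts H \<subseteq> pverts G"
      and arc: "\<And>u v. u \<in> pverts H \<Longrightarrow> v \<in> pverts H \<Longrightarrow>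
        (f u, f v) \<in> parcs G \<longleftrightarrow> (u, v) \<in> parcs H"
      by blast
    define P where "P = \<lparr> pverts = f ` pverts H,
      parcs = {e \<in> parcs G. fst e \<in> f ` pverts H \<and> snd e \<in> f ` pverts H} \<rparr>"
    have P: "pair_graph P"
    proof
      show "finite (parcs P)"
        using G.pair_finite_arcs by (auto simp: P_def intro: finite_subset)
      show "symmetric (with_proj P)"
        by (auto simp: symmetric_def P_def intro!: symI dest: G.arcs_symmetric)
    qed (auto simp: P_def dest: G.no_loops')
    then interpret P: pair_graph P .
    have "bij_betw (inv_into (pverts H) f) (pverts P) (pverts H)"
      using inj by (auto simp: P_def intro!: bij_betw_inv_into inj_on_imp_bij_betw)
    moreover have "\<forall>u\<in>pverts P. \<forall>v\<in>pverts P. (u, v) \<in> parcs P \<longleftrightarrow>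
      (inv_into (pverts H) f u, inv_into (pverts H) f v) \<in> parcs H"
      using arc inj by (auto simp: P_def)
    ultimately have "graph_isomorphic P H"
      unfolding graph_isomorphic_iff[OF P assms(2)] by blast
    moreover have "induced_subgraph (with_proj P) (with_proj G)"
      using im P.wf_digraph_axioms G.wf_digraph_axioms
      by (auto simp: induced_subgraph_def subgraph_def compatible_def P_def)
    ultimately show "\<exists>S. induced_subgraph S (with_proj G) \<and> digraph_iso S (with_proj H)"
      unfolding graph_isomorphic_def by blast
  qed
  then show ?thesis
    by (simp add: induced_free_def)
qed

text \<open>An embedding of a graph on the vertices 0, ..., n - 1 is the list of its values. For
  numeral \<open>n\<close> the bounded quantifiers then unfold to finitely many arc
  conditions.\<close>

lemma induced_free_iff_list:
  assumes "pair_graph G" "pair_graph H" "pverts H = {..<n}"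
  shows "induced_free H G \<longleftrightarrow>
    \<not> (\<exists>xs. length xs = n \<and> distinct xs \<and> set xs \<subseteq> pverts G \<and>
      (\<forall>i<n. \<forall>j<n. (xs ! i, xs ! j) \<in> parcs G \<longleftrightarrow> (i, j) \<in> parcs H))"
    (is "_ \<longleftrightarrow> \<not> ?R")
proof -
  have "?R \<longleftrightarrow> (\<exists>f. inj_on f {..<n} \<and> f ` {..<n} \<subseteq> pverts G \<and>
      (\<forall>u\<in>{..<n}. \<forall>v\<in>{..<n}. (f u, f v) \<in> parcs G \<longleftrightarrow> (u, v) \<in> parcs H))" (is "_ \<longleftrightarrow> ?F")
  proof
    assume ?R
    then obtain xs where "length xs = n" "distinct xs" "set xs \<subseteq> pverts G"
      "\<forall>i<n. \<forall>j<n. (xs ! i, xs ! j) \<in> parcs G \<longleftrightarrow> (i, j) \<in> parcs H"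
      by blast
    then show ?F
      by (intro exI[of _ "(!) xs"]) (auto simp: inj_on_nth)
  next
    assume ?F
    then obtain f where "inj_on f {..<n}" "f ` {..<n} \<subseteq> pverts G"
      "\<forall>u\<in>{..<n}. \<forall>v\<in>{..<n}. (f u, f v) \<in> parcs G \<longleftrightarrow> (u, v) \<in> parcs H"
      by blast
    then show ?R
      by (intro exI[of _ "map f [0..<n]"]) (auto simp: distinct_map atLeast0LessThan)
  qed
  then show ?thesis
    by (simp only: induced_free_iff_embedding[OF assms(1,2)] assms(3))
qed

text \<open>The isomorphism sends each vertex to its position in \<open>xs\<close>; it inverts the
  bijection from positions to entries.\<close>

lemma graph_isomorphic_by_list:
  assumes "pair_graph G" "pair_graph H" "pverts H = {..<length xs}"
    and "distinct xs" "set xs = pverts G"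
    and "\<forall>i<length xs. \<forall>j<length xs. (xs ! i, xs ! j) \<in> parcs G \<longleftrightarrow> (i, j) \<in> parcs H"
  shows "graph_isomorphic G H"
proof -
  have bij: "bij_betw ((!) xs) {..<length xs} (pverts G)"
    using assms(4,5) by (intro bij_betw_nth) auto
  let ?f = "inv_into {..<length xs} ((!) xs)"
  have f: "?f u < length xs" "xs ! ?f u = u" if "u \<in> pverts G" for u
    using that bij bij_betwE[OF bij_betw_inv_into[OF bij]]
    by (auto simp: bij_betw_inv_into_right)
  have "(u, v) \<in> parcs G \<longleftrightarrow> (?f u, ?f v) \<in> parcs H"
    if "u \<in> pverts G" "v \<in> pverts G" for u v
    using assms(6) f that by metis
  then show ?thesis
    unfolding graph_isomorphic_iff[OF assms(1,2)] assms(3)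
    using bij_betw_inv_into[OF bij] by blast
qed

section \<open>Claws and bulls\<close>

text \<open>The centre comes first and the leaves are ordered. That the centre differs from the
  leaves follows in a loop-free graph, and membership in the vertex set follows from the
  arcs.\<close>

definition claw_at :: "'a pair_pre_digraph \<Rightarrow> 'a \<Rightarrow> 'a \<Rightarrow> 'a \<Rightarrow> 'a \<Rightarrow> bool" where
  "claw_at G b x y z \<longleftrightarrow> (b, x) \<in> parcs G \<and> (b, y) \<in> parcs G \<and> (b, z) \<in> parcs G \<and>
     x \<noteq> y \<and> x \<noteq> z \<and> y \<noteq> z \<and> (x, y) \<notin> parcs G \<and> (x, z) \<notin> parcs G \<and> (y, z) \<notin> parcs G"

lemma pair_graph_complete_bipartite: "pair_graph (complete_bipartite m n)"
  unfolding complete_bipartite_def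
  by (intro pair_graph_graph_of_edges) (auto simp: irrefl_def)

lemma pverts_complete_bipartite:
  assumes "m > 0" "n > 0"
  shows "pverts (complete_bipartite m n) = {..<m + n}"
proof -
  have "Domain ({0..<m} \<times> {m..<m + n}) = {0..<m}"
    \<comment> \<open>As \<open>n > 0\<close>, the vertex \<open>m\<close> lies in the second part,
      so it is a partner for every vertex of the first.\<close>
    using assms by (auto simp: Domain_iff intro!: exI[of _ m])
  moreover have "Range ({0..<m} \<times> {m..<m + n}) = {m..<m + n}"
    using assms by (auto simp: Range_iff)
  ultimately show ?thesis
    by (auto simp: complete_bipartite_def graph_of_edges_def Field_def)
qed

lemma parcs_complete_bipartite:
  "(i, j) \<in> parcs (complete_bipartite m n) \<longleftrightarrow>
    i < m \<and> m \<le> j \<and> j < m + n \<or> j < m \<and> m \<le> i \<and> i < m + n"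
  by (auto simp: complete_bipartite_def graph_of_edges_def)

lemma lessThan_4_5_6:
  "{..<4::nat} = {0, 1, 2, 3}" "{..<5::nat} = {0, 1, 2, 3, 4}"
  "{..<6::nat} = {0, 1, 2, 3, 4, 5}"
  by auto

lemma pair_graph_claw_plus_one: "pair_graph claw_plus_one"
  unfolding claw_plus_one_def by (intro pair_graph_graph_of_edges) (auto simp: irrefl_def)

lemma pverts_claw_plus_one: "pverts claw_plus_one = {..<5}"
  unfolding lessThan_4_5_6 by (auto simp: claw_plus_one_def graph_of_edges_def)

lemma pair_graph_claw_plus_two: "pair_graph claw_plus_two"
  unfolding claw_plus_two_def by (intro pair_graph_graph_of_edges) (auto simp: irrefl_def)

lemma pverts_claw_plus_two: "pverts claw_plus_two = {..<6}"
  unfolding lessThan_4_5_6 by (auto simp: claw_plus_two_def graph_of_edges_def)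

lemma pair_graph_K23_plus_one: "pair_graph K23_plus_one"
  unfolding K23_plus_one_def by (intro pair_graph_graph_of_edges) (auto simp: irrefl_def)

lemma pverts_K23_plus_one: "pverts K23_plus_one = {..<6}"
  unfolding lessThan_4_5_6 by (auto simp: K23_plus_one_def graph_of_edges_def)

lemma pair_graph_bull: "pair_graph bull"
  unfolding bull_def by (intro pair_graph_graph_of_edges) (auto simp: irrefl_def)

lemma pverts_bull: "pverts bull = {..<5}"
  unfolding lessThan_4_5_6 by (auto simp: bull_def graph_of_edges_def)

context pair_graph
begin

lemma parcs_sym: "(u, v) \<in> parcs G \<longleftrightarrow> (v, u) \<in> parcs G"
  using arcs_symmetric by blast

lemma not_loop: "(v, v) \<notin> parcs G"
  using no_loops' by blast

lemma induced_free_claw_iff: "induced_free claw G \<longleftrightarrow> \<not> (\<exists>b x y z. claw_at G b x y z)"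
proof -
  have "pverts claw = {..<4}"
    by (simp add: pverts_complete_bipartite)
  note free = induced_free_iff_list[OF pair_graph_axioms pair_graph_complete_bipartite this]
  have "(\<exists>xs. length xs = 4 \<and> distinct xs \<and> set xs \<subseteq> pverts G \<and>
      (\<forall>i<4. \<forall>j<4. (xs ! i, xs ! j) \<in> parcs G \<longleftrightarrow> (i, j) \<in> parcs claw)) \<longleftrightarrow>
    (\<exists>b x y z. claw_at G b x y z)" (is "?L \<longleftrightarrow> ?R")
  proof
    assume ?L
    then obtain xs where "length xs = 4" and xs: "distinct xs"
      "\<forall>i<4. \<forall>j<4. (xs ! i, xs ! j) \<in> parcs G \<longleftrightarrow> (i, j) \<in> parcs claw"
      by blast
    then obtain b x y z where "xs = [b, x, y, z]"
      by (auto simp: numeral_eq_Suc length_Suc_conv)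
    with xs have "claw_at G b x y z"
      by (simp add: claw_at_def parcs_complete_bipartite numeral_eq_Suc All_less_Suc)
    then show ?R
      by blast
  next
    assume ?R
    then obtain b x y z where c: "claw_at G b x y z"
      by blast
    then have "b \<noteq> x" "b \<noteq> y" "b \<noteq> z"
      by (auto simp: claw_at_def not_loop)
    with c show ?L
      by (intro exI[of _ "[b, x, y, z]"])
        (auto simp: claw_at_def parcs_complete_bipartite numeral_eq_Suc All_less_Suc
          not_loop parcs_sym dest: in_arcsD1 in_arcsD2)
  qed
  then show ?thesis
    by (simp only: free)
qed

lemma claw_at_perms:
  assumes "claw_at G b x y z"
  shows "claw_at G b x z y" "claw_at G b y x z" "claw_at G b y z x" "claw_at G b z x y"
    "claw_at G b z y x"
  using assms by (auto simp: claw_at_def parcs_sym)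

text \<open>The five vertices are distinct because the listed arcs and non-arcs tell them apart: for
  instance \<open>a\<close> is adjacent to \<open>d\<close> but not to \<open>e\<close>.\<close>

lemma bull_not_induced_free:
  assumes "(a, b) \<in> parcs G" "(b, c) \<in> parcs G" "(a, c) \<in> parcs G"
    and "(a, d) \<in> parcs G" "(b, e) \<in> parcs G"
    and "(a, e) \<notin> parcs G" "(b, d) \<notin> parcs G" "(c, d) \<notin> parcs G" "(c, e) \<notin> parcs G"
    and "(d, e) \<notin> parcs G"
  shows "\<not> induced_free bull G"
proof -
  have sym: "(b, a) \<in> parcs G" "(c, b) \<in> parcs G" "(c, a) \<in> parcs G" "(d, a) \<in> parcs G"
    "(e, b) \<in> parcs G" "(e, a) \<notin> parcs G" "(d, b) \<notin> parcs G" "(d, c) \<notin> parcs G"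
    "(e, c) \<notin> parcs G" "(e, d) \<notin> parcs G"
    using assms parcs_sym by blast+
  have "distinct [a, b, c, d, e]"
    using assms sym by (auto simp: no_loops')
  moreover have "set [a, b, c, d, e] \<subseteq> pverts G"
    using assms by (auto dest: in_arcsD1 in_arcsD2)
  moreover have "\<forall>i<5. \<forall>j<5. ([a, b, c, d, e] ! i, [a, b, c, d, e] ! j) \<in> parcs G \<longleftrightarrow>
      (i, j) \<in> parcs bull"
    using assms sym
    by (simp add: bull_def graph_of_edges_def numeral_eq_Suc All_less_Suc not_loop)
  ultimately show ?thesis
    unfolding induced_free_iff_list[OF pair_graph_axioms pair_graph_bull pverts_bull]
    unfolding not_not by (intro exI[of _ "[a, b, c, d, e]"]) simp
qed

end

section \<open>Contractions\<close>

lemma parcs_contract_edge [simp]: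
  "(Some x, Some y) \<in> parcs (contract_edge G u v) \<longleftrightarrow>
    (x, y) \<in> parcs G \<and> x \<notin> {u, v} \<and> y \<notin> {u, v}"
  "(None, Some x) \<in> parcs (contract_edge G u v) \<longleftrightarrow>
    ((u, x) \<in> parcs G \<or> (v, x) \<in> parcs G) \<and> x \<notin> {u, v}"
  "(Some x, None) \<in> parcs (contract_edge G u v) \<longleftrightarrow>
    ((u, x) \<in> parcs G \<or> (v, x) \<in> parcs G) \<and> x \<notin> {u, v}"
  "(None, None) \<notin> parcs (contract_edge G u v)"
  by (auto simp: contract_edge_def nbrs_def)

context pair_graph
begin

text \<open>Since \<open>u\<close> has no claw with leaves \<open>x\<close>, \<open>y\<close>,
  \<open>z\<close>, it misses \<open>z\<close>. It has none with leaves \<open>x\<close>,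
  \<open>y\<close>, \<open>v\<close> either, so \<open>v\<close> sees \<open>x\<close> or
  \<open>y\<close>, but not both, as \<open>v\<close> would then have a claw with \<open>x\<close>,
  \<open>y\<close>, \<open>z\<close>. If \<open>v\<close> sees \<open>x\<close>, the triangle
  \<open>u\<close>, \<open>v\<close>, \<open>x\<close> with \<open>y\<close> at \<open>u\<close> and
  \<open>z\<close> at \<open>v\<close> is a bull; the other case is symmetric.\<close>

lemma contract_edge_claw_free_if_two_one:
  assumes free: "\<And>b x y z. \<not> claw_at G b x y z" and bull: "induced_free bull G"
    and uv: "(u, v) \<in> parcs G"
    and xyz: "(u, x) \<in> parcs G" "(u, y) \<in> parcs G" "(v, z) \<in> parcs G"
      "z \<noteq> u" "x \<noteq> v" "y \<noteq> v"
    and indep: "x \<noteq> y" "x \<noteq> z" "y \<noteq> z" "(x, y) \<notin> parcs G" "(x, z) \<notin> parcs G" "(y, z) \<notin> parcs G"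
  shows False
proof -
  have uz: "(u, z) \<notin> parcs G"
    using free[of u x y z] xyz indep by (auto simp: claw_at_def)
  have "(v, x) \<in> parcs G \<or> (v, y) \<in> parcs G"
    using free[of u x y v] uv xyz indep by (auto simp: claw_at_def parcs_sym)
  moreover have "\<not> ((v, x) \<in> parcs G \<and> (v, y) \<in> parcs G)"
    using free[of v x y z] xyz indep by (auto simp: claw_at_def)
  ultimately show False
    using bull_not_induced_free[of u v x y z] bull_not_induced_free[of u v y x z]
      bull uv uz xyz indep parcs_sym by blast
qed

lemma contract_edge_claw_free:
  assumes free: "induced_free claw G" and bull: "induced_free bull G" and uv: "(u, v) \<in> parcs G"
  shows "induced_free claw (contract_edge G u v)"
proof -
  interpret C: pair_graph "contract_edge G u v"
    using pair_graph_axioms by (rule pair_graph_contract_edge)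
  have no: "\<not> claw_at G b x y z" for b x y z
    using free induced_free_claw_iff by blast
  \<comment> \<open>If the new vertex is a leaf, one end of the contracted edge is adjacent to the
    centre and can replace it.\<close>
  have leaf: "\<not> claw_at (contract_edge G u v) (Some b) None (Some x) (Some y)" for b x y
    using no[of b u x y] no[of b v x y]
    by (auto simp: claw_at_def parcs_sym)
  have centre: "\<not> claw_at (contract_edge G u v) None (Some x) (Some y) (Some z)" for x y z
  proof
    assume c: "claw_at (contract_edge G u v) None (Some x) (Some y) (Some z)"
    note two_one = contract_edge_claw_free_if_two_one[OF no bull]
    have vu: "(v, u) \<in> parcs G"
      using uv parcs_sym by blast
    have ind: "x \<noteq> y" "x \<noteq> z" "y \<noteq> z" "(x, y) \<notin> parcs G" "(x, z) \<notin> parcs G" "(y, z) \<notin> parcs G"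
      "y \<noteq> x" "z \<noteq> x" "z \<noteq> y" "(y, x) \<notin> parcs G" "(z, x) \<notin> parcs G" "(z, y) \<notin> parcs G"
      and out: "x \<noteq> u" "x \<noteq> v" "y \<noteq> u" "y \<noteq> v" "z \<noteq> u" "z \<noteq> v"
      and adj: "(u, x) \<in> parcs G \<or> (v, x) \<in> parcs G" "(u, y) \<in> parcs G \<or> (v, y) \<in> parcs G"
        "(u, z) \<in> parcs G \<or> (v, z) \<in> parcs G"
      using c parcs_sym unfolding claw_at_def by auto
    \<comment> \<open>Neither end sees all three leaves, but every leaf is seen by some end. So one
      end sees two leaves and the other end sees the third; the six instances choose the end and the
      third leaf.\<close>
    have "\<not> ((u, x) \<in> parcs G \<and> (u, y) \<in> parcs G \<and> (u, z) \<in> parcs G)"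
      "\<not> ((v, x) \<in> parcs G \<and> (v, y) \<in> parcs G \<and> (v, z) \<in> parcs G)"
      using no[of u x y z] no[of v x y z] ind by (auto simp: claw_at_def)
    then show False
      using adj two_one[OF uv, of x y z] two_one[OF uv, of x z y] two_one[OF uv, of y z x]
        two_one[OF vu, of x y z] two_one[OF vu, of x z y] two_one[OF vu, of y z x] ind out
      by blast
  qed
  have old: "\<not> claw_at (contract_edge G u v) (Some b) (Some x) (Some y) (Some z)" for b x y z
    using no[of b x y z] by (auto simp: claw_at_def)
  have leaf': "\<not> claw_at (contract_edge G u v) (Some b) (Some x) None (Some y)"
    "\<not> claw_at (contract_edge G u v) (Some b) (Some x) (Some y) None" for b x y
    using leaf C.claw_at_perms(2,4) by blast+
  \<comment> \<open>The new vertex cannot occur twice: leaves are distinct and it has no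
    loop.\<close>
  have twice: "\<not> claw_at (contract_edge G u v) p None None q"
    "\<not> claw_at (contract_edge G u v) p None q None" "\<not> claw_at (contract_edge G u v) p q None None"
    "\<not> claw_at (contract_edge G u v) None None p q"
    "\<not> claw_at (contract_edge G u v) None p None q"
    "\<not> claw_at (contract_edge G u v) None p q None" for p q
    by (auto simp: claw_at_def)
  have "\<not> claw_at (contract_edge G u v) b x y z" for b x y z
    by (cases b; cases x; cases y; cases z) (simp_all add: old leaf leaf' centre twice)
  then show ?thesis
    using C.induced_free_claw_iff by blast
qed

end

section \<open>Graphs with a claw all of whose contractions are claw-free\<close>

text \<open>Hypotheses for the converse direction. With \<open>contract\<close> phrased by
  \<open>claw_at\<close>, a local fact is proved by choosing an edge and naming the claw that its
  contraction would create.\<close>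

locale contractions_claw_free = pair_graph G for G :: "'a pair_pre_digraph" +
  assumes no_isolated: "no_isolated_verts G"
    and contract: "(u, v) \<in> parcs G \<Longrightarrow> \<not> claw_at (contract_edge G u v) p q r s"
begin

section \<open>Adjacencies of the vertices outside a claw\<close>

text \<open>For a fourth neighbour \<open>d\<close>, contracting \<open>bd\<close> gives a vertex
  that is still the centre of a claw with leaves \<open>x\<close>, \<open>y\<close>,
  \<open>z\<close>.\<close>

lemma centre_nbr:
  assumes c: "claw_at G b x y z" and d: "(b, d) \<in> parcs G"
  shows "d \<in> {x, y, z}"
proof (rule ccontr)
  assume "d \<notin> {x, y, z}"
  then have "claw_at (contract_edge G b d) None (Some x) (Some y) (Some z)"
    using c by (auto simp: claw_at_def not_loop)
  then show False
    using contract[OF d] by blast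
qed

text \<open>Contracting an edge disjoint from the claw would leave the claw intact.\<close>

lemma outside_independent:
  assumes c: "claw_at G b x y z" and "u \<notin> {b, x, y, z}" "v \<notin> {b, x, y, z}"
  shows "(u, v) \<notin> parcs G"
proof
  assume uv: "(u, v) \<in> parcs G"
  have "claw_at (contract_edge G u v) (Some b) (Some x) (Some y) (Some z)"
    using assms by (auto simp: claw_at_def)
  then show False
    using contract[OF uv] by blast
qed

text \<open>If \<open>x\<close> were the only leaf seen by \<open>d\<close>, the vertex made from
  \<open>dx\<close> would take over the role of the leaf \<open>x\<close>.\<close>

lemma outside_not_pendant:
  assumes c: "claw_at G b x y z" and d: "(d, x) \<in> parcs G" "d \<notin> {b, x, y, z}"
  shows "(d, y) \<in> parcs G \<or> (d, z) \<in> parcs G"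
proof (rule ccontr)
  assume no: "\<not> ((d, y) \<in> parcs G \<or> (d, z) \<in> parcs G)"
  have "b \<noteq> x" "b \<noteq> d"
    using c d by (auto simp: claw_at_def not_loop)
  then have "claw_at (contract_edge G d x) (Some b) None (Some y) (Some z)"
    using c d no by (auto simp: claw_at_def parcs_sym)
  then show False
    using contract[OF d(1)] by blast
qed

lemma outside_two_leaves:
  assumes c: "claw_at G b x y z" and d: "d \<in> pverts G" "d \<notin> {b, x, y, z}"
  shows "(d, x) \<in> parcs G \<and> (d, y) \<in> parcs G \<or> (d, x) \<in> parcs G \<and> (d, z) \<in> parcs G \<or>
    (d, y) \<in> parcs G \<and> (d, z) \<in> parcs G"
proof -
  \<comment> \<open>A neighbour of \<open>d\<close> exists since no vertex is isolated. It lies in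
    the claw and is not the centre, hence is a leaf, and \<open>outside_not_pendant\<close> supplies
    a second leaf.\<close>
  obtain w where w: "(d, w) \<in> parcs G"
    using no_isolated d by (auto simp: no_isolated_verts_def nbrs_def)
  have "w \<in> {b, x, y, z}"
    using outside_independent[OF c d(2)] w by blast
  moreover have "w \<noteq> b"
    using w centre_nbr[OF c, of d] d parcs_sym by blast
  ultimately have "(d, x) \<in> parcs G \<or> (d, y) \<in> parcs G \<or> (d, z) \<in> parcs G"
    using w by blast
  then show ?thesis
    using outside_not_pendant[OF c, of d] outside_not_pendant[OF claw_at_perms(2)[OF c], of d]
      outside_not_pendant[OF claw_at_perms(4)[OF c], of d] d by blast
qed

text \<open>Otherwise contracting \<open>bx\<close> gives a centre with the independent leaves
  \<open>z\<close>, \<open>d\<close>, \<open>d'\<close>. This excludes two outside vertices attached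
  to exactly the same two leaves.\<close>

lemma outside_no_twins:
  assumes c: "claw_at G b x y z" and d: "d \<notin> {b, x, y, z}" "d' \<notin> {b, x, y, z}" "d \<noteq> d'"
    and x: "(d, x) \<in> parcs G" "(d', x) \<in> parcs G"
  shows "(d, z) \<in> parcs G \<or> (d', z) \<in> parcs G"
proof (rule ccontr)
  assume no: "\<not> ((d, z) \<in> parcs G \<or> (d', z) \<in> parcs G)"
  have "b \<noteq> z"
    using c by (auto simp: claw_at_def not_loop)
  then have "claw_at (contract_edge G b x) None (Some z) (Some d) (Some d')"
    using c d x no outside_independent[OF c d(1,2)] by (auto simp: claw_at_def parcs_sym)
  moreover have "(b, x) \<in> parcs G"
    using c by (simp add: claw_at_def)
  ultimately show False
    using contract by blast
qed

text \<open>The common leaf \<open>x\<close> is the centre of a second claw, with leaves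
  \<open>b\<close>, \<open>d\<close>, \<open>d'\<close>. A further vertex \<open>w\<close> would see
  two of these, hence \<open>d\<close> or \<open>d'\<close>; but all three of \<open>w\<close>,
  \<open>d\<close>, \<open>d'\<close> lie outside the first claw and are independent.\<close>

lemma pverts_if_common_leaf:
  assumes c: "claw_at G b x y z" and d: "d \<notin> {b, x, y, z}" "d' \<notin> {b, x, y, z}" "d \<noteq> d'"
    and x: "(d, x) \<in> parcs G" "(d', x) \<in> parcs G"
  shows "pverts G \<subseteq> {b, x, y, z, d, d'}"
proof
  fix w assume w: "w \<in> pverts G"
  show "w \<in> {b, x, y, z, d, d'}"
  proof (rule ccontr)
    assume out: "w \<notin> {b, x, y, z, d, d'}"
    have "(b, d) \<notin> parcs G" "(b, d') \<notin> parcs G"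
      using centre_nbr[OF c] d by blast+
    then have "claw_at G x b d d'"
      using c d x outside_independent[OF c d(1,2)] by (auto simp: claw_at_def parcs_sym)
    then have "(w, d) \<in> parcs G \<or> (w, d') \<in> parcs G"
      using outside_two_leaves[of x b d d' w] w out by blast
    then show False
      using outside_independent[OF c] out d by blast
  qed
qed

section \<open>Recognising the six exceptional graphs\<close>

text \<open>Here and in the next five lemmas, position \<open>i\<close> of the list holds the vertex
  numbered \<open>i\<close> in the target graph.\<close>

lemma iso_claw:
  assumes c: "claw_at G b x y z" and V: "pverts G = {b, x, y, z}"
  shows "graph_isomorphic G (complete_bipartite 1 3)"
proof (rule graph_isomorphic_by_list[of _ _ "[b, x, y, z]"])
  show "distinct [b, x, y, z]"
    using c by (auto simp: claw_at_def not_loop)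
  show "\<forall>i<length [b, x, y, z]. \<forall>j<length [b, x, y, z].
    ([b, x, y, z] ! i, [b, x, y, z] ! j) \<in> parcs G \<longleftrightarrow> (i, j) \<in> parcs (complete_bipartite 1 3)"
    using assms by (auto simp: parcs_complete_bipartite claw_at_def numeral_eq_Suc
      All_less_Suc not_loop parcs_sym)
qed (use V in \<open>simp_all add: insert_commute pair_graph_axioms
  pair_graph_complete_bipartite pverts_complete_bipartite\<close>)

lemma iso_claw_plus_one:
  assumes c: "claw_at G b x y z" and V: "pverts G = {b, x, y, z, d}" and d: "d \<notin> {b, x, y, z}"
    and "(d, x) \<notin> parcs G" "(d, y) \<in> parcs G" "(d, z) \<in> parcs G"
  shows "graph_isomorphic G claw_plus_one"
proof (rule graph_isomorphic_by_list[of _ _ "[b, x, y, z, d]"])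
  have bd: "(b, d) \<notin> parcs G"
    using centre_nbr[OF c] d by blast
  show "distinct [b, x, y, z, d]"
    using c d by (auto simp: claw_at_def not_loop)
  show "\<forall>i<length [b, x, y, z, d]. \<forall>j<length [b, x, y, z, d].
    ([b, x, y, z, d] ! i, [b, x, y, z, d] ! j) \<in> parcs G \<longleftrightarrow> (i, j) \<in> parcs claw_plus_one"
    using assms bd by (auto simp: claw_plus_one_def graph_of_edges_def claw_at_def numeral_eq_Suc
      All_less_Suc not_loop parcs_sym)
qed (use V in \<open>simp_all add: insert_commute pair_graph_axioms
  pair_graph_claw_plus_one pverts_claw_plus_one\<close>)

text \<open>\<open>d\<close> moves next to \<open>b\<close>, because these two form the part
  numbered 0, 1.\<close>

lemma iso_K23:
  assumes c: "claw_at G b x y z" and V: "pverts G = {b, x, y, z, d}" and d: "d \<notin> {b, x, y, z}"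
    and "(d, x) \<in> parcs G" "(d, y) \<in> parcs G" "(d, z) \<in> parcs G"
  shows "graph_isomorphic G (complete_bipartite 2 3)"
proof (rule graph_isomorphic_by_list[of _ _ "[b, d, x, y, z]"])
  have bd: "(b, d) \<notin> parcs G"
    using centre_nbr[OF c] d by blast
  show "distinct [b, d, x, y, z]"
    using c d by (auto simp: claw_at_def not_loop)
  show "\<forall>i<length [b, d, x, y, z]. \<forall>j<length [b, d, x, y, z].
    ([b, d, x, y, z] ! i, [b, d, x, y, z] ! j) \<in> parcs G \<longleftrightarrow> (i, j) \<in> parcs (complete_bipartite 2 3)"
    using assms bd by (auto simp: parcs_complete_bipartite claw_at_def numeral_eq_Suc
      All_less_Suc not_loop parcs_sym)
qed (use V in \<open>simp_all add: insert_commute pair_graph_axioms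
  pair_graph_complete_bipartite pverts_complete_bipartite\<close>)

text \<open>The leaf \<open>y\<close> shared by \<open>d\<close> and \<open>d'\<close> must be in
  the middle position, as \<open>c\<^sub>2\<close>.\<close>

lemma iso_claw_plus_two:
  assumes c: "claw_at G b x y z" and V: "pverts G = {b, x, y, z, d, d'}"
    and d: "d \<notin> {b, x, y, z}" "d' \<notin> {b, x, y, z}" "d \<noteq> d'"
    and "(d, x) \<notin> parcs G" "(d, y) \<in> parcs G" "(d, z) \<in> parcs G"
    and "(d', x) \<in> parcs G" "(d', y) \<in> parcs G" "(d', z) \<notin> parcs G"
  shows "graph_isomorphic G claw_plus_two"
proof (rule graph_isomorphic_by_list[of _ _ "[b, x, y, z, d, d']"])
  have no: "(b, d) \<notin> parcs G" "(b, d') \<notin> parcs G" "(d, d') \<notin> parcs G"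
    using centre_nbr[OF c] outside_independent[OF c] d by blast+
  show "distinct [b, x, y, z, d, d']"
    using c d by (auto simp: claw_at_def not_loop)
  show "\<forall>i<length [b, x, y, z, d, d']. \<forall>j<length [b, x, y, z, d, d'].
    ([b, x, y, z, d, d'] ! i, [b, x, y, z, d, d'] ! j) \<in> parcs G \<longleftrightarrow> (i, j) \<in> parcs claw_plus_two"
    using assms no by (auto simp: claw_plus_two_def graph_of_edges_def claw_at_def numeral_eq_Suc
      All_less_Suc not_loop parcs_sym)
qed (use V in \<open>simp_all add: insert_commute pair_graph_axioms
  pair_graph_claw_plus_two pverts_claw_plus_two\<close>)

lemma iso_K23_plus_one:
  assumes c: "claw_at G b x y z" and V: "pverts G = {b, x, y, z, d, d'}"
    and d: "d \<notin> {b, x, y, z}" "d' \<notin> {b, x, y, z}" "d \<noteq> d'"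
    and "(d, x) \<in> parcs G" "(d, y) \<in> parcs G" "(d, z) \<in> parcs G"
    and "(d', x) \<notin> parcs G" "(d', y) \<in> parcs G" "(d', z) \<in> parcs G"
  shows "graph_isomorphic G K23_plus_one"
proof (rule graph_isomorphic_by_list[of _ _ "[b, d, x, y, z, d']"])
  have no: "(b, d) \<notin> parcs G" "(b, d') \<notin> parcs G" "(d, d') \<notin> parcs G"
    using centre_nbr[OF c] outside_independent[OF c] d by blast+
  show "distinct [b, d, x, y, z, d']"
    using c d by (auto simp: claw_at_def not_loop)
  show "\<forall>i<length [b, d, x, y, z, d']. \<forall>j<length [b, d, x, y, z, d'].
    ([b, d, x, y, z, d'] ! i, [b, d, x, y, z, d'] ! j) \<in> parcs G \<longleftrightarrow> (i, j) \<in> parcs K23_plus_one"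
    using assms no by (auto simp: K23_plus_one_def graph_of_edges_def claw_at_def numeral_eq_Suc
      All_less_Suc not_loop parcs_sym)
qed (use V in \<open>simp_all add: insert_commute pair_graph_axioms
  pair_graph_K23_plus_one pverts_K23_plus_one\<close>)

lemma iso_K33:
  assumes c: "claw_at G b x y z" and V: "pverts G = {b, x, y, z, d, d'}"
    and d: "d \<notin> {b, x, y, z}" "d' \<notin> {b, x, y, z}" "d \<noteq> d'"
    and "(d, x) \<in> parcs G" "(d, y) \<in> parcs G" "(d, z) \<in> parcs G"
    and "(d', x) \<in> parcs G" "(d', y) \<in> parcs G" "(d', z) \<in> parcs G"
  shows "graph_isomorphic G (complete_bipartite 3 3)"
proof (rule graph_isomorphic_by_list[of _ _ "[b, d, d', x, y, z]"])
  have no: "(b, d) \<notin> parcs G" "(b, d') \<notin> parcs G" "(d, d') \<notin> parcs G"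
    using centre_nbr[OF c] outside_independent[OF c] d by blast+
  show "distinct [b, d, d', x, y, z]"
    using c d by (auto simp: claw_at_def not_loop)
  show "\<forall>i<length [b, d, d', x, y, z]. \<forall>j<length [b, d, d', x, y, z].
    ([b, d, d', x, y, z] ! i, [b, d, d', x, y, z] ! j) \<in> parcs G \<longleftrightarrow>
      (i, j) \<in> parcs (complete_bipartite 3 3)"
    using assms no by (auto simp: parcs_complete_bipartite claw_at_def numeral_eq_Suc
      All_less_Suc not_loop parcs_sym)
qed (use V in \<open>simp_all add: insert_commute pair_graph_axioms
  pair_graph_complete_bipartite pverts_complete_bipartite\<close>)

section \<open>Case analysis by the number of outside vertices\<close>

text \<open>Three attached leaves give \<open>K\<^sub>2\<^sub>,\<^sub>3\<close>. With two, the claw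
  is permuted so that the leaf missed by \<open>d\<close> comes first.\<close>

lemma exceptional_if_one_outside:
  assumes c: "claw_at G b x y z" and V: "pverts G = {b, x, y, z, d}" and d: "d \<notin> {b, x, y, z}"
  shows "graph_isomorphic G (complete_bipartite 2 3) \<or> graph_isomorphic G claw_plus_one"
proof -
  have "d \<in> pverts G"
    using V by simp
  note two = outside_two_leaves[OF c this d]
  have V': "pverts G = {b, y, x, z, d}" "pverts G = {b, z, x, y, d}"
    and d': "d \<notin> {b, y, x, z}" "d \<notin> {b, z, x, y}"
    using V d by auto
  show ?thesis
    using two iso_K23[OF c V d] iso_claw_plus_one[OF c V d]
      iso_claw_plus_one[OF claw_at_perms(2)[OF c] V'(1) d'(1)]
      iso_claw_plus_one[OF claw_at_perms(4)[OF c] V'(2) d'(2)] by blast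
qed

lemma exceptional_if_common_leaf:
  assumes c: "claw_at G b x y z" and d: "d \<in> pverts G" "d' \<in> pverts G"
      "d \<notin> {b, x, y, z}" "d' \<notin> {b, x, y, z}" "d \<noteq> d'"
    and x: "(d, x) \<in> parcs G" "(d', x) \<in> parcs G"
  shows "graph_isomorphic G (complete_bipartite 3 3) \<or> graph_isomorphic G claw_plus_two \<or>
    graph_isomorphic G K23_plus_one"
proof -
  have "{b, x, y, z, d, d'} \<subseteq> pverts G"
    using c d by (auto simp: claw_at_def dest: in_arcsD1 in_arcsD2)
  then have V: "pverts G = {b, x, y, z, d, d'}" "pverts G = {b, y, x, z, d, d'}"
      "pverts G = {b, z, x, y, d, d'}" "pverts G = {b, y, x, z, d', d}"
      "pverts G = {b, z, x, y, d', d}"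
    using pverts_if_common_leaf[OF c d(3-5) x] by auto
  have out: "d \<notin> {b, y, x, z}" "d' \<notin> {b, y, x, z}" "d' \<noteq> d" "d \<notin> {b, z, x, y}" "d' \<notin> {b, z, x, y}"
    using d by auto
  note c' = claw_at_perms(2,4)[OF c]
  \<comment> \<open>Each of \<open>d\<close>, \<open>d'\<close> misses at most one of
    \<open>y\<close>, \<open>z\<close>, and they do not miss the same one.\<close>
  have "(d, y) \<in> parcs G \<or> (d', y) \<in> parcs G" "(d, z) \<in> parcs G \<or> (d', z) \<in> parcs G"
    using outside_no_twins[OF c d(3-5) x]
      outside_no_twins[OF claw_at_perms(1)[OF c], of d d'] d x by auto
  moreover have "(d, y) \<in> parcs G \<or> (d, z) \<in> parcs G" "(d', y) \<in> parcs G \<or> (d', z) \<in> parcs G"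
    using outside_not_pendant[OF c] d x by blast+
  \<comment> \<open>If neither misses a leaf, the graph is \<open>K\<^sub>3\<^sub>,\<^sub>3\<close>.
    If exactly one does, the missed leaf is put first, giving \<open>K23_plus_one\<close> in four
    ways. If both do, \<open>x\<close> becomes the middle leaf of
    \<open>claw_plus_two\<close>.\<close>
  ultimately show ?thesis
    using x iso_K33[OF c V(1) d(3-5)]
      iso_K23_plus_one[OF c'(1) V(2) out(1,2) d(5)]
      iso_K23_plus_one[OF c'(2) V(3) out(4,5) d(5)]
      iso_K23_plus_one[OF c'(1) V(4) out(2,1,3)]
      iso_K23_plus_one[OF c'(2) V(5) out(5,4,3)]
      iso_claw_plus_two[OF c'(1) V(2) out(1,2) d(5)]
      iso_claw_plus_two[OF c'(1) V(4) out(2,1,3)]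
    by blast
qed

lemma exceptional_if_claw:
  assumes c: "claw_at G b x y z"
  shows "graph_isomorphic G (complete_bipartite 1 3) \<or>
    graph_isomorphic G (complete_bipartite 2 3) \<or> graph_isomorphic G (complete_bipartite 3 3) \<or>
    graph_isomorphic G claw_plus_one \<or> graph_isomorphic G claw_plus_two \<or>
    graph_isomorphic G K23_plus_one"
proof -
  have sub: "{b, x, y, z} \<subseteq> pverts G"
    using c by (auto simp: claw_at_def dest: in_arcsD1 in_arcsD2)
  consider "pverts G = {b, x, y, z}"
    | d where "d \<notin> {b, x, y, z}" "pverts G = {b, x, y, z, d}"
    | d d' where "d \<in> pverts G" "d' \<in> pverts G" "d \<notin> {b, x, y, z}" "d' \<notin> {b, x, y, z}" "d \<noteq> d'"
    using sub by blast
  then show ?thesis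
  proof cases
    case 1
    then show ?thesis
      using iso_claw[OF c] by blast
  next
    case 2
    then show ?thesis
      using exceptional_if_one_outside[OF c] by blast
  next
    case (3 d d')
    \<comment> \<open>Two sets of at least two leaves out of three intersect.\<close>
    have "(d, x) \<in> parcs G \<and> (d', x) \<in> parcs G \<or> (d, y) \<in> parcs G \<and> (d', y) \<in> parcs G \<or>
      (d, z) \<in> parcs G \<and> (d', z) \<in> parcs G"
      using outside_two_leaves[OF c 3(1,3)] outside_two_leaves[OF c 3(2,4)] by blast
    then show ?thesis
      using exceptional_if_common_leaf[OF c 3]
        exceptional_if_common_leaf[OF claw_at_perms(2)[OF c], of d d']
        exceptional_if_common_leaf[OF claw_at_perms(4)[OF c], of d d'] 3 by blast
  qed
qed

end

theorem theorem19:
  fixes G :: "'a pair_pre_digraph"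
  assumes "pair_graph G"
    and "no_isolated_verts G"
    and "induced_free bull G"
    and "\<not> graph_isomorphic G (complete_bipartite 1 3)"
    and "\<not> graph_isomorphic G (complete_bipartite 2 3)"
    and "\<not> graph_isomorphic G (complete_bipartite 3 3)"
    and "\<not> graph_isomorphic G claw_plus_one"
    and "\<not> graph_isomorphic G claw_plus_two"
    and "\<not> graph_isomorphic G K23_plus_one"
  shows "induced_free claw G \<longleftrightarrow>
    (\<forall>u v. (u, v) \<in> parcs G \<longrightarrow> induced_free claw (contract_edge G u v))"
proof
  interpret pair_graph G by fact
  show "\<forall>u v. (u, v) \<in> parcs G \<longrightarrow> induced_free claw (contract_edge G u v)"
    if "induced_free claw G"
    using contract_edge_claw_free[OF that assms(3)] by blast
  assume free: "\<forall>u v. (u, v) \<in> parcs G \<longrightarrow> induced_free claw (contract_edge G u v)"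
  have "\<not> claw_at (contract_edge G u v) p q r s" if "(u, v) \<in> parcs G" for u v p q r s
    using free that pair_graph.induced_free_claw_iff[OF pair_graph_contract_edge[OF assms(1)]]
    by blast
  then interpret contractions_claw_free G
    using assms(2) by unfold_locales
  show "induced_free claw G"
    unfolding induced_free_claw_iff using exceptional_if_claw assms(4-9) by blast
qed

end
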